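(* Let $G$ and $H$ be two non-trivial connected graphs of order $n_1$ and $n_2$, having $t_1$ and $t_2$ true twin equivalence classes, respectively. Then: (i) If $\dim_l(G)=n_1-t_1$ and $\dim_l(H)=n_2-t_2$, then $\dim_l(G\boxtimes H)= n_1n_2-t_1t_2$. (ii) If $\dim_l(G)=n_1-t_1$ and $H$ is bipartite, then $n_2(n_1-t_1)\le \dim_l(G\boxtimes H)\le n_2(n_1-t_1)+t_1$.
   Context: Two vertices $u,v$ are true twins if $N_G[u]=N_G[v]$ (closed neighborhoods); the true twin equivalence classes are the classes of the relation $N_G[x]=N_G[y]$. A set $S$ is a local metric generator for a connected graph $G$ if for every two adjacent vertices $x,y$ there is $s\in S$ with $d_G(s,x)\ne d_G(s,y)$; $\dim_l(G)$ is the minimum cardinality of a local metric generator. The strong product $G\boxtimes H$ has vertex set $V(G)\times V(H)$, with $(a,b)\sim(c,d)$ iff ($a=c$ and $b\sim d$) or ($b=d$ and $a\sim c$) or ($a\sim c$ and $b\sim d$). *)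

theory Defs
  imports "Graph_Theory.Graph_Theory"
begin

text \<open>
  A finite simple undirected graph is a \<open>pair_graph\<close>: a finite, loop-free digraph
  with a symmetric set of arcs, each arc being the pair of its end vertices.
\<close>

text \<open>
  The distance is the infimum of the lengths of all walks, i.e. the library's shortest path
  cost \<open>\<mu>\<close> for unit weights. It is \<open>\<infinity>\<close> for vertices in different components.
\<close>

definition gdist :: "'a pair_pre_digraph \<Rightarrow> 'a \<Rightarrow> 'a \<Rightarrow> ereal" where
  "gdist G u v = wf_digraph.\<mu> (with_proj G) (\<lambda>_. 1) u v"

definition closed_nbhd :: "'a pair_pre_digraph \<Rightarrow> 'a \<Rightarrow> 'a set" where
  "closed_nbhd G u = insert u {v. (u, v) \<in> parcs G}"

definition true_twin_rel :: "'a pair_pre_digraph \<Rightarrow> 'a rel" where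
  "true_twin_rel G =
     {(u, v). u \<in> pverts G \<and> v \<in> pverts G \<and> closed_nbhd G u = closed_nbhd G v}"

definition true_twin_classes :: "'a pair_pre_digraph \<Rightarrow> 'a set set" where
  "true_twin_classes G = pverts G // true_twin_rel G"

definition local_metric_generator :: "'a pair_pre_digraph \<Rightarrow> 'a set \<Rightarrow> bool" where
  "local_metric_generator G S \<longleftrightarrow> S \<subseteq> pverts G \<and>
     (\<forall>x y. (x, y) \<in> parcs G \<longrightarrow> (\<exists>s\<in>S. gdist G s x \<noteq> gdist G s y))"

definition local_metric_dim :: "'a pair_pre_digraph \<Rightarrow> nat" where
  "local_metric_dim G = (LEAST k. \<exists>S. local_metric_generator G S \<and> card S = k)"

definition strong_product ::
  "'a pair_pre_digraph \<Rightarrow> 'b pair_pre_digraph \<Rightarrow> ('a \<times> 'b) pair_pre_digraph"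
  (infixl \<open>\<boxtimes>\<close> 70) where
  "G \<boxtimes> H = \<lparr> pverts = pverts G \<times> pverts H,
     parcs = {((a, b), (c, d)) | a b c d.
       a \<in> pverts G \<and> b \<in> pverts H \<and> c \<in> pverts G \<and> d \<in> pverts H \<and>
       (a = c \<and> (b, d) \<in> parcs H \<or>
        b = d \<and> (a, c) \<in> parcs G \<or>
        (a, c) \<in> parcs G \<and> (b, d) \<in> parcs H)} \<rparr>"

definition bipartite :: "'a pair_pre_digraph \<Rightarrow> bool" where
  "bipartite G \<longleftrightarrow> (\<exists>U V. pverts G = U \<union> V \<and> U \<inter> V = {} \<and> parcs G \<subseteq> U \<times> V \<union> V \<times> U)"

text \<open>
  By the next lemma, truncation plays no role in the difference of the order of a graph
  and its number of true twin classes.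
\<close>

lemma card_true_twin_classes_le:
  assumes "finite (pverts G)"
  shows "card (true_twin_classes G) \<le> card (pverts G)"
proof -
  have "true_twin_classes G = (\<lambda>x. true_twin_rel G `` {x}) ` pverts G"
    by (auto simp: true_twin_classes_def quotient_def)
  then show ?thesis
    using assms by (simp add: card_image_le)
qed

lemma equiv_true_twin_rel: "equiv (pverts G) (true_twin_rel G)"
  by (auto simp: equiv_def refl_on_def sym_def trans_def true_twin_rel_def)

lemma pair_graph_strong_product:
  assumes "pair_graph G" "pair_graph H"
  shows "pair_graph (G \<boxtimes> H)"
proof -
  interpret G: pair_graph G by fact
  interpret H: pair_graph H by fact
  have G_sym: "(c, a) \<in> parcs G" if "(a, c) \<in> parcs G" for a c
    using that G.arcs_symmetric by blast
  have H_sym: "(d, b) \<in> parcs H" if "(b, d) \<in> parcs H" for b d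
    using that H.arcs_symmetric by blast
  have fin: "finite (parcs (G \<boxtimes> H))"
    by (rule finite_subset[where B = "(pverts G \<times> pverts H) \<times> (pverts G \<times> pverts H)"])
       (auto simp: strong_product_def)
  show ?thesis
  proof
    show "finite (pverts (G \<boxtimes> H))" by (simp add: strong_product_def)
    show "finite (parcs (G \<boxtimes> H))" by (rule fin)
    show "fst e \<in> pverts (G \<boxtimes> H)" if "e \<in> parcs (G \<boxtimes> H)" for e
      using that by (auto simp: strong_product_def)
    show "snd e \<in> pverts (G \<boxtimes> H)" if "e \<in> parcs (G \<boxtimes> H)" for e
      using that by (auto simp: strong_product_def)
    show "fst e \<noteq> snd e" if "e \<in> parcs (G \<boxtimes> H)" for e
      using that G.no_loops' H.no_loops' by (auto simp: strong_product_def)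
    show "symmetric (with_proj (G \<boxtimes> H))"
      by (auto simp: symmetric_def sym_def arcs_ends_def arc_to_ends_def strong_product_def
          intro: G_sym H_sym)
  qed
qed

end

theory Submission
  imports Defs
begin

text \<open>
  Distances in a strong product are maxima of distances in the factors. Hence, if \<open>S\<close> and \<open>T\<close> are
  local metric generators of \<open>G\<close> and \<open>H\<close>, then the complement of
  \<open>(V(G) - S) \<times> (V(H) - T)\<close> is one of \<open>G \<boxtimes> H\<close>. In (i), minimum generators \<open>S\<close> and \<open>T\<close> omit
  \<open>t1\<close> and \<open>t2\<close> vertices; in (ii), a single vertex generates the bipartite graph \<open>H\<close>. For the lower
  bounds, a generator contains all but at most one vertex of each true twin class, and there are
  at most \<open>t1 * t2\<close> classes in \<open>G \<boxtimes> H\<close> since closed neighbourhoods there are products of closed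
  neighbourhoods.
\<close>

section \<open>Distances via powers of the arc relation\<close>

locale connected_pair_graph = pair_graph +
  assumes connected_G: "connected (with_proj G)"

text \<open>Distance as a natural number. Relation powers, unlike lists of arcs, split componentwise
  in a product. The value is unspecified if no power relates \<open>u\<close> to \<open>v\<close>;
  between vertices of a connected graph this cannot happen.\<close>

definition ndist :: "'a pair_pre_digraph \<Rightarrow> 'a \<Rightarrow> 'a \<Rightarrow> nat" where
  "ndist G u v = (LEAST k. (u, v) \<in> parcs G ^^ k)"

lemma ndist_le: "(u, v) \<in> parcs G ^^ k \<Longrightarrow> ndist G u v \<le> k"
  unfolding ndist_def by (rule Least_le)

lemma ndist_self [simp]: "ndist G u u = 0"
  using ndist_le[of u u 0 G] by simp

text \<open>A reflexive step is a pause, so walks of length at most \<open>k\<close> become walks of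
  length exactly \<open>k\<close>. This lets walks of different lengths in two factors run in
  parallel.\<close>

lemma relpow_reflcl_iff: "(x, y) \<in> (E\<^sup>=) ^^ k \<longleftrightarrow> (\<exists>i\<le>k. (x, y) \<in> E ^^ i)"
proof (induction k arbitrary: y)
  case (Suc k)
  show ?case
  proof
    assume "(x, y) \<in> (E\<^sup>=) ^^ Suc k"
    then obtain z i where zi: "i \<le> k" "(x, z) \<in> E ^^ i" "(z, y) \<in> E\<^sup>="
      by (auto simp: Suc.IH elim!: relpow_Suc_E)
    then show "\<exists>i\<le>Suc k. (x, y) \<in> E ^^ i"
      by (cases "z = y") (auto intro: relpow_Suc_I exI[of _ "Suc i"] exI[of _ i])
  next
    assume "\<exists>i\<le>Suc k. (x, y) \<in> E ^^ i"
    then obtain i where i: "i \<le> Suc k" "(x, y) \<in> E ^^ i" by blast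
    show "(x, y) \<in> (E\<^sup>=) ^^ Suc k"
    proof (cases "i \<le> k")
      case True
      with i Suc.IH have "(x, y) \<in> (E\<^sup>=) ^^ k" by blast
      \<comment> \<open>The additional step is a pause at \<open>y\<close>.\<close>
      then show ?thesis by (rule relpow_Suc_I) simp
    next
      case False
      with i have "(x, y) \<in> E ^^ Suc k" by (simp add: le_Suc_eq)
      then obtain z where "(x, z) \<in> E ^^ k" "(z, y) \<in> E" by (rule relpow_Suc_E)
      with Suc.IH[of z] show ?thesis by (blast intro: relpow_Suc_I)
    qed
  qed
qed simp

context pair_wf_digraph
begin

lemma relpow_in_pverts: "(u, v) \<in> parcs G ^^ k \<Longrightarrow> u \<in> pverts G \<Longrightarrow> v \<in> pverts G"
  by (cases k) (auto dest: in_arcsD2)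

lemma awalk_imp_relpow: "awalk u p v \<Longrightarrow> (u, v) \<in> parcs G ^^ length p"
  by (induction p arbitrary: u) (auto simp: awalk_Nil_iff awalk_Cons_iff simp del: relpow.simps(2) intro: relpow_Suc_I2)

text \<open>The assumption on \<open>u\<close> matters for \<open>k = 0\<close>: the zeroth power
  relates everything to itself, whereas the empty walk exists only at vertices.\<close>

lemma relpow_imp_awalk:
  "(u, v) \<in> parcs G ^^ k \<Longrightarrow> u \<in> pverts G \<Longrightarrow> \<exists>p. awalk u p v \<and> length p = k"
proof (induction k arbitrary: u)
  case (Suc k)
  then obtain w where w: "(u, w) \<in> parcs G" "(w, v) \<in> parcs G ^^ k"
    by (blast elim: relpow_Suc_E2)
  with Suc.IH obtain p where "awalk w p v" "length p = k"
    using in_arcsD2 by blast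
  with w show ?case
    by (intro exI[of _ "(u, w) # p"]) (auto simp: awalk_Cons_iff)
qed (auto simp: awalk_Nil_iff)

end

context connected_pair_graph
begin

lemma connected_relpow:
  assumes "u \<in> pverts G" "v \<in> pverts G"
  shows "\<exists>k. (u, v) \<in> parcs G ^^ k"
proof -
  have "strongly_connected (with_proj G)"
    using connected_G pair_sym_arcs by (rule symmetric_connected_imp_strongly_connected[rotated])
  then have "u \<rightarrow>\<^sup>*\<^bsub>with_proj G\<^esub> v"
    using assms by (auto simp: strongly_connected_def)
  then show ?thesis
    using awalk_imp_relpow by (auto simp: reachable_awalk)
qed

lemma relpow_ndist:
  assumes "u \<in> pverts G" "v \<in> pverts G"
  shows "(u, v) \<in> parcs G ^^ ndist G u v"
  unfolding ndist_def using connected_relpow[OF assms] by (rule LeastI_ex)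

text \<open>The length of every walk is an admissible exponent, and the least exponent comes from a
  walk, so the infimum is attained.\<close>

lemma gdist_eq_ndist:
  assumes "u \<in> pverts G" "v \<in> pverts G"
  shows "gdist G u v = ereal (real (ndist G u v))"
proof -
  have cost: "awalk_cost (\<lambda>_. 1) p = real (length p)" for p :: "('a \<times> 'a) list"
    by (induction p) auto
  obtain p where p: "awalk u p v" "length p = ndist G u v"
    using relpow_imp_awalk[OF relpow_ndist[OF assms] assms(1)] by blast
  show ?thesis
    unfolding gdist_def \<mu>_def cost
  proof (rule INF_eqI)
    fix q assume "q \<in> {p. awalk u p v}"
    then show "ereal (real (ndist G u v)) \<le> ereal (real (length q))"
      using ndist_le[OF awalk_imp_relpow] by simp
  next
    fix y assume "\<And>q. q \<in> {p. awalk u p v} \<Longrightarrow> y \<le> ereal (real (length q))"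
    then show "y \<le> ereal (real (ndist G u v))"
      using p by fastforce
  qed
qed

lemma ndist_eq_0_iff:
  assumes "u \<in> pverts G" "v \<in> pverts G"
  shows "ndist G u v = 0 \<longleftrightarrow> u = v"
  using relpow_ndist[OF assms] by (metis ndist_self relpow_0_E)

lemma ndist_le_iff:
  assumes "u \<in> pverts G" "v \<in> pverts G"
  shows "ndist G u v \<le> k \<longleftrightarrow> (u, v) \<in> ((parcs G)\<^sup>=) ^^ k"
  unfolding relpow_reflcl_iff using relpow_ndist[OF assms] by (meson ndist_le le_trans)

section \<open>Local metric generators and true twins\<close>

lemma local_metric_generator_iff:
  "local_metric_generator G S \<longleftrightarrow> S \<subseteq> pverts G \<and>
    (\<forall>x y. (x, y) \<in> parcs G \<longrightarrow> (\<exists>s\<in>S. ndist G s x \<noteq> ndist G s y))"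
proof (cases "S \<subseteq> pverts G")
  case True
  have "gdist G s x \<noteq> gdist G s y \<longleftrightarrow> ndist G s x \<noteq> ndist G s y"
    if "s \<in> S" "(x, y) \<in> parcs G" for s x y
    using that(1) True wellformed'[OF that(2)] by (simp add: gdist_eq_ndist subset_iff)
  with True show ?thesis unfolding local_metric_generator_def by blast
qed (simp add: local_metric_generator_def)

text \<open>Ensures that the \<open>LEAST\<close> defining the dimension is attained. An end of an
  arc resolves it, having distance 0 only to itself.\<close>

lemma local_metric_generator_pverts: "local_metric_generator G (pverts G)"
  unfolding local_metric_generator_iff
proof (intro conjI allI impI)
  fix x y assume xy: "(x, y) \<in> parcs G"
  then have "x \<in> pverts G" "y \<in> pverts G" "x \<noteq> y" by (auto dest: wellformed' no_loops')
  then show "\<exists>s\<in>pverts G. ndist G s x \<noteq> ndist G s y"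
    using ndist_eq_0_iff[of x y] by (intro bexI[of _ x]) auto
qed simp

lemma local_metric_dim_attained:
  obtains S where "local_metric_generator G S" "card S = local_metric_dim G"
proof -
  have "\<exists>S. local_metric_generator G S \<and> card S = local_metric_dim G"
    unfolding local_metric_dim_def
    by (rule LeastI_ex) (use local_metric_generator_pverts in blast)
  with that show thesis by blast
qed

text \<open>The last vertex before \<open>x\<close> on a shortest walk from \<open>s\<close> lies in
  the closed neighbourhood shared with \<open>y\<close>, so redirecting the last step reaches
  \<open>y\<close> no later. The condition \<open>s \<noteq> x\<close> provides this last
  step.\<close>

lemma ndist_twin_le:
  assumes s: "s \<in> pverts G" and x: "x \<in> pverts G" and "s \<noteq> x"
    and twin: "closed_nbhd G x = closed_nbhd G y"
  shows "ndist G s y \<le> ndist G s x"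
proof -
  obtain k where k: "ndist G s x = Suc k"
    using ndist_eq_0_iff[OF s x] \<open>s \<noteq> x\<close> not0_implies_Suc by blast
  then obtain w where w: "(s, w) \<in> parcs G ^^ k" "(w, x) \<in> parcs G"
    using relpow_ndist[OF s x] by (metis relpow_Suc_E)
  then have "w \<in> closed_nbhd G x"
    using arcs_symmetric by (auto simp: closed_nbhd_def)
  then have "w = y \<or> (w, y) \<in> parcs G"
    unfolding twin using arcs_symmetric by (auto simp: closed_nbhd_def)
  then show ?thesis
  proof
    assume "w = y"
    with w(1) k show ?thesis using ndist_le[of s y k G] by simp
  next
    assume "(w, y) \<in> parcs G"
    with w(1) k show ?thesis using ndist_le[OF relpow_Suc_I] by metis
  qed
qed

text \<open>Two distinct twins outside \<open>S\<close> would be adjacent and, by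
  \<open>ndist_twin_le\<close> in both directions, equidistant from every vertex of
  \<open>S\<close>. So vertices outside \<open>S\<close> have distinct closed
  neighbourhoods.\<close>

lemma card_pverts_le_generator_plus_twins:
  assumes S: "local_metric_generator G S"
  shows "card (pverts G) \<le> card S + card (closed_nbhd G ` pverts G)"
proof -
  have sub: "S \<subseteq> pverts G" using S by (simp add: local_metric_generator_iff)
  have "inj_on (closed_nbhd G) (pverts G - S)"
  proof (rule inj_onI, rule ccontr)
    fix x y assume xy: "x \<in> pverts G - S" "y \<in> pverts G - S"
      and twin: "closed_nbhd G x = closed_nbhd G y" and "x \<noteq> y"
    then have "(x, y) \<in> parcs G" by (auto simp: closed_nbhd_def)
    then obtain s where "s \<in> S" "ndist G s x \<noteq> ndist G s y"
      using S unfolding local_metric_generator_iff by blast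
    moreover have "ndist G s x = ndist G s y" if "s \<in> S"
      using that xy sub twin by (intro antisym ndist_twin_le) auto
    ultimately show False by blast
  qed
  then have "card (pverts G - S) \<le> card (closed_nbhd G ` pverts G)"
    by (intro card_inj_on_le[of "closed_nbhd G"]) (auto simp: pair_finite_verts)
  moreover have "card (pverts G) = card (pverts G - S) + card S"
    using sub pair_finite_verts by (metis card_mono card_Diff_subset finite_subset le_add_diff_inverse2)
  ultimately show ?thesis by simp
qed

end

lemma local_metric_dim_le: "local_metric_generator G S \<Longrightarrow> local_metric_dim G \<le> card S"
  unfolding local_metric_dim_def by (rule Least_le) blast

text \<open>The classes are the fibres of \<open>closed_nbhd\<close> on the vertices; each is
  nonempty and hence determines its neighbourhood.\<close>

lemma card_true_twin_classes: "card (true_twin_classes G) = card (closed_nbhd G ` pverts G)"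
proof -
  have "true_twin_classes G =
      (\<lambda>N. {v \<in> pverts G. closed_nbhd G v = N}) ` closed_nbhd G ` pverts G"
    by (auto simp: true_twin_classes_def quotient_def true_twin_rel_def)
  moreover have "inj_on (\<lambda>N. {v \<in> pverts G. closed_nbhd G v = N}) (closed_nbhd G ` pverts G)"
    by (rule inj_onI) auto
  ultimately show ?thesis by (simp add: card_image)
qed

text \<open>The parity of the distance from \<open>r\<close> tells the side of a vertex, and the
  ends of an arc lie on different sides.\<close>

lemma (in connected_pair_graph) bipartite_singleton_generator:
  assumes "bipartite G" and r: "r \<in> pverts G"
  shows "local_metric_generator G {r}"
proof -
  obtain U V where UV: "U \<inter> V = {}" "parcs G \<subseteq> U \<times> V \<union> V \<times> U"
    using assms(1) by (auto simp: bipartite_def)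
  have parity: "x \<in> U \<longleftrightarrow> (r \<in> U \<longleftrightarrow> even k)" if "(r, x) \<in> parcs G ^^ k" for x k
    using that
  proof (induction k arbitrary: x)
    case (Suc k)
    then obtain w where "(r, w) \<in> parcs G ^^ k" "(w, x) \<in> parcs G" by (blast elim: relpow_Suc_E)
    with Suc.IH[of w] UV show ?case by auto
  qed simp
  have "ndist G r x \<noteq> ndist G r y" if "(x, y) \<in> parcs G" for x y
  proof
    assume eq: "ndist G r x = ndist G r y"
    have "x \<in> U \<longleftrightarrow> y \<in> U"
      using parity[OF relpow_ndist[OF r, of x]] parity[OF relpow_ndist[OF r, of y]]
        wellformed'[OF that] eq by simp
    with that UV show False by auto
  qed
  with r show ?thesis by (simp add: local_metric_generator_iff)
qed

section \<open>Distances and neighbourhoods in the strong product\<close>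

lemma in_closed_nbhd_iff: "v \<in> closed_nbhd G u \<longleftrightarrow> (u, v) \<in> (parcs G)\<^sup>="
  by (auto simp: closed_nbhd_def)

lemma pverts_strong_product [simp]: "pverts (G \<boxtimes> H) = pverts G \<times> pverts H"
  by (simp add: strong_product_def)

locale two_connected_pair_graphs =
  G: connected_pair_graph G + H: connected_pair_graph H
  for G :: "'a pair_pre_digraph" and H :: "'b pair_pre_digraph"
begin

text \<open>Allowing pauses merges the three kinds of adjacency, and equality, into one
  componentwise condition.\<close>

lemma strong_product_arc_iff:
  assumes "a \<in> pverts G" "b \<in> pverts H"
  shows "((a, b), (c, d)) \<in> (parcs (G \<boxtimes> H))\<^sup>= \<longleftrightarrow>
    (a, c) \<in> (parcs G)\<^sup>= \<and> (b, d) \<in> (parcs H)\<^sup>="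
  using assms by (auto simp: strong_product_def dest: G.in_arcsD2 H.in_arcsD2)

lemma strong_product_relpow_iff:
  assumes "a \<in> pverts G" "b \<in> pverts H"
  shows "((a, b), (c, d)) \<in> ((parcs (G \<boxtimes> H))\<^sup>=) ^^ k \<longleftrightarrow>
    (a, c) \<in> ((parcs G)\<^sup>=) ^^ k \<and> (b, d) \<in> ((parcs H)\<^sup>=) ^^ k"
proof (induction k arbitrary: c d)
  case (Suc k)
  have "((a, b), (c, d)) \<in> ((parcs (G \<boxtimes> H))\<^sup>=) ^^ Suc k \<longleftrightarrow>
      (\<exists>e f. ((a, b), (e, f)) \<in> ((parcs (G \<boxtimes> H))\<^sup>=) ^^ k \<and>
        ((e, f), (c, d)) \<in> (parcs (G \<boxtimes> H))\<^sup>=)"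
    by auto
  also have "\<dots> \<longleftrightarrow> (\<exists>e f. (a, e) \<in> ((parcs G)\<^sup>=) ^^ k \<and> (b, f) \<in> ((parcs H)\<^sup>=) ^^ k \<and>
        (e, c) \<in> (parcs G)\<^sup>= \<and> (f, d) \<in> (parcs H)\<^sup>=)"
  proof -
    \<comment> \<open>\<open>strong_product_arc_iff\<close> applies only at vertices, so the
      intermediate points must be shown to be vertices.\<close>
    have "e \<in> pverts G \<and> f \<in> pverts H"
      if "(a, e) \<in> ((parcs G)\<^sup>=) ^^ k" "(b, f) \<in> ((parcs H)\<^sup>=) ^^ k" for e f
      using that assms unfolding relpow_reflcl_iff
      by (blast intro: G.relpow_in_pverts H.relpow_in_pverts)
    then show ?thesis unfolding Suc.IH using strong_product_arc_iff by blast
  qed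
  also have "\<dots> \<longleftrightarrow> (a, c) \<in> ((parcs G)\<^sup>=) ^^ Suc k \<and> (b, d) \<in> ((parcs H)\<^sup>=) ^^ Suc k"
    by auto
  finally show ?case .
qed auto

sublocale P: connected_pair_graph "G \<boxtimes> H"
proof -
  interpret P: pair_graph "G \<boxtimes> H"
    by (rule pair_graph_strong_product) unfold_locales
  have "u \<rightarrow>\<^sup>*\<^bsub>with_proj (G \<boxtimes> H)\<^esub> v"
    if u: "u \<in> pverts (G \<boxtimes> H)" and v: "v \<in> pverts (G \<boxtimes> H)" for u v
  proof -
    obtain a b c d where uv: "u = (a, b)" "v = (c, d)" by fastforce
    with u v have V: "a \<in> pverts G" "b \<in> pverts H" "c \<in> pverts G" "d \<in> pverts H" by auto
    \<comment> \<open>The shorter of the two walks is padded with pauses to the length of the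
      longer.\<close>
    define k where "k = max (ndist G a c) (ndist H b d)"
    have "((a, b), (c, d)) \<in> ((parcs (G \<boxtimes> H))\<^sup>=) ^^ k"
      using V by (simp add: strong_product_relpow_iff k_def flip: G.ndist_le_iff H.ndist_le_iff)
    then obtain i where "(u, v) \<in> parcs (G \<boxtimes> H) ^^ i"
      using uv by (auto simp: relpow_reflcl_iff)
    from P.relpow_imp_awalk[OF this u] show ?thesis
      by (auto simp: P.reachable_awalk)
  qed
  moreover have "pverts (G \<boxtimes> H) \<noteq> {}"
    using G.connected_G H.connected_G by (auto simp: connected_conv)
  ultimately have "connected (with_proj (G \<boxtimes> H))"
    \<comment> \<open>\<open>connected\<close> means strong connectivity of the symmetric closure,
      which inherits reachability.\<close>
    unfolding connected_def
    by (intro strongly_connectedI P.reachable_mk_symmetricI) simp_all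
  then show "connected_pair_graph (G \<boxtimes> H)" by unfold_locales
qed

text \<open>Both sides have the same upper bounds \<open>k\<close>: a padded walk of length
  \<open>k\<close> in the product is a pair of such walks in the factors.\<close>

lemma ndist_strong_product:
  assumes "a \<in> pverts G" "b \<in> pverts H" "c \<in> pverts G" "d \<in> pverts H"
  shows "ndist (G \<boxtimes> H) (a, b) (c, d) = max (ndist G a c) (ndist H b d)"
proof -
  have "ndist (G \<boxtimes> H) (a, b) (c, d) \<le> k \<longleftrightarrow> max (ndist G a c) (ndist H b d) \<le> k" for k
    using assms by (simp add: P.ndist_le_iff G.ndist_le_iff H.ndist_le_iff strong_product_relpow_iff)
  then show ?thesis by (meson le_antisym order_refl)
qed

lemma closed_nbhd_strong_product:
  assumes "a \<in> pverts G" "b \<in> pverts H"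
  shows "closed_nbhd (G \<boxtimes> H) (a, b) = closed_nbhd G a \<times> closed_nbhd H b"
proof (rule set_eqI)
  fix z show "z \<in> closed_nbhd (G \<boxtimes> H) (a, b) \<longleftrightarrow> z \<in> closed_nbhd G a \<times> closed_nbhd H b"
    using strong_product_arc_iff[OF assms]
    by (cases z) (simp only: in_closed_nbhd_iff mem_Times_iff fst_conv snd_conv)
qed

section \<open>Bounds for the local metric dimension of the strong product\<close>

lemma card_true_twin_classes_strong_product_le:
  "card (true_twin_classes (G \<boxtimes> H)) \<le> card (true_twin_classes G) * card (true_twin_classes H)"
proof -
  let ?A = "closed_nbhd G ` pverts G" and ?B = "closed_nbhd H ` pverts H"
  have "closed_nbhd (G \<boxtimes> H) ` pverts (G \<boxtimes> H) \<subseteq> (\<lambda>(A, B). A \<times> B) ` (?A \<times> ?B)"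
    by (force simp: closed_nbhd_strong_product)
  moreover have "finite (?A \<times> ?B)" by (simp add: G.pair_finite_verts H.pair_finite_verts)
  ultimately have "card (closed_nbhd (G \<boxtimes> H) ` pverts (G \<boxtimes> H)) \<le> card (?A \<times> ?B)"
    by (meson surj_card_le)
  then show ?thesis by (simp add: card_true_twin_classes card_cartesian_product)
qed

lemma local_metric_dim_strong_product_ge:
  "card (pverts G) * card (pverts H) - card (true_twin_classes G) * card (true_twin_classes H)
    \<le> local_metric_dim (G \<boxtimes> H)"
proof -
  obtain S where "local_metric_generator (G \<boxtimes> H) S" "card S = local_metric_dim (G \<boxtimes> H)"
    by (rule P.local_metric_dim_attained)
  then have "card (pverts (G \<boxtimes> H)) \<le> local_metric_dim (G \<boxtimes> H) + card (true_twin_classes (G \<boxtimes> H))"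
    using P.card_pverts_le_generator_plus_twins by (metis card_true_twin_classes)
  with card_true_twin_classes_strong_product_le show ?thesis
    by (simp add: card_cartesian_product)
qed

text \<open>The set is the union of \<open>S \<times> pverts H\<close> and
  \<open>pverts G \<times> T\<close>; the complement form makes its size a single subtraction. The
  second kind of vertex resolves arcs with constant first coordinate, the first kind all
  others.\<close>

lemma local_metric_generator_strong_product:
  assumes S: "local_metric_generator G S" and T: "local_metric_generator H T"
  shows "local_metric_generator (G \<boxtimes> H)
    (pverts G \<times> pverts H - (pverts G - S) \<times> (pverts H - T))"
    (is "local_metric_generator _ ?R")
  unfolding P.local_metric_generator_iff
proof (intro conjI allI impI)
  show "?R \<subseteq> pverts (G \<boxtimes> H)" by (simp add: Diff_subset)
next
  have S': "S \<subseteq> pverts G" and T': "T \<subseteq> pverts H"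
    using S T by (auto simp: local_metric_generator_def)
  fix x y assume xy: "(x, y) \<in> parcs (G \<boxtimes> H)"
  obtain a b c d where eq: "x = (a, b)" "y = (c, d)" by fastforce
  have V: "a \<in> pverts G" "b \<in> pverts H" "c \<in> pverts G" "d \<in> pverts H"
    and arc: "(a, c) \<in> parcs G \<and> (b, d) \<in> (parcs H)\<^sup>= \<or> a = c \<and> (b, d) \<in> parcs H"
    using xy eq by (auto simp: strong_product_def)
  from arc show "\<exists>s\<in>?R. ndist (G \<boxtimes> H) s x \<noteq> ndist (G \<boxtimes> H) s y"
  proof
    assume "a = c \<and> (b, d) \<in> parcs H"
    moreover from this obtain t where t: "t \<in> T" "ndist H t b \<noteq> ndist H t d"
      using T unfolding H.local_metric_generator_iff by blast
    moreover from t have "t \<in> pverts H" using T' by blast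
    \<comment> \<open>From \<open>(a, t)\<close> the first coordinate contributes distance 0,
      leaving the distances from \<open>t\<close> in \<open>H\<close>.\<close>
    ultimately show ?thesis
      using V eq by (intro bexI[of _ "(a, t)"]) (simp_all add: ndist_strong_product)
  next
    assume ac: "(a, c) \<in> parcs G \<and> (b, d) \<in> (parcs H)\<^sup>="
    then obtain s where s: "s \<in> S" "ndist G s a \<noteq> ndist G s c"
      using S unfolding G.local_metric_generator_iff by blast
    then have sV: "s \<in> pverts G" using S' by blast
    \<comment> \<open>The farther of \<open>a\<close> and \<open>c\<close> has distance at least 1
      from \<open>s\<close>, so a distance of at most 1 in \<open>H\<close> does not change the
      maximum.\<close>
    have bd: "ndist H b d \<le> 1" "ndist H d b \<le> 1"
      using ac H.arcs_symmetric ndist_le[of _ _ 1 H] by auto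
    \<comment> \<open>the second coordinate is that of the endpoint whose first coordinate is nearer to \<open>s\<close>\<close>
    show ?thesis
    proof (cases "ndist G s a < ndist G s c")
      case True
      have "ndist (G \<boxtimes> H) (s, b) (a, b) = ndist G s a"
        using sV V by (simp add: ndist_strong_product)
      moreover have "ndist (G \<boxtimes> H) (s, b) (c, d) = ndist G s c"
        using sV V bd True by (simp add: ndist_strong_product)
      moreover have "(s, b) \<in> ?R" using s(1) sV V by simp
      ultimately show ?thesis using s(2) eq by metis
    next
      case False
      have "ndist (G \<boxtimes> H) (s, d) (c, d) = ndist G s c"
        using sV V by (simp add: ndist_strong_product)
      moreover have "ndist (G \<boxtimes> H) (s, d) (a, b) = ndist G s a"
        using sV V bd s(2) False by (simp add: ndist_strong_product)
      moreover have "(s, d) \<in> ?R" using s(1) sV V by simp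
      ultimately show ?thesis using s(2) eq by metis
    qed
  qed
qed

text \<open>Kept for arbitrary generators: (i) takes a minimum generator for \<open>T\<close>, (ii)
  a singleton.\<close>

lemma local_metric_dim_strong_product_le:
  assumes "local_metric_generator G S" and "local_metric_generator H T"
  shows "local_metric_dim (G \<boxtimes> H)
    \<le> card (pverts G) * card (pverts H) - (card (pverts G) - card S) * (card (pverts H) - card T)"
proof -
  have sub: "S \<subseteq> pverts G" "T \<subseteq> pverts H"
    using assms by (auto simp: local_metric_generator_def)
  then have fin: "finite S" "finite T"
    by (auto intro: finite_subset)
  have "card (pverts G \<times> pverts H - (pverts G - S) \<times> (pverts H - T)) =
      card (pverts G \<times> pverts H) - card ((pverts G - S) \<times> (pverts H - T))"
    using G.pair_finite_verts H.pair_finite_verts by (intro card_Diff_subset) auto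
  also have "\<dots> = card (pverts G) * card (pverts H) -
      (card (pverts G) - card S) * (card (pverts H) - card T)"
    using sub fin by (simp add: card_cartesian_product card_Diff_subset)
  finally show ?thesis
    using local_metric_dim_le[OF local_metric_generator_strong_product[OF assms]] by simp
qed

end

theorem theorem11:
  fixes G :: "'a pair_pre_digraph" and H :: "'b pair_pre_digraph"
    and n1 n2 t1 t2 :: nat
  assumes "pair_graph G" and "connected (with_proj G)"
    and "pair_graph H" and "connected (with_proj H)"
    and "n1 = card (pverts G)" and "n1 \<ge> 2"
    and "n2 = card (pverts H)" and "n2 \<ge> 2"
    and "t1 = card (true_twin_classes G)"
    and "t2 = card (true_twin_classes H)"
  shows "(local_metric_dim G = n1 - t1 \<and> local_metric_dim H = n2 - t2 \<longrightarrow>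
            local_metric_dim (G \<boxtimes> H) = n1 * n2 - t1 * t2) \<and>
         (local_metric_dim G = n1 - t1 \<and> bipartite H \<longrightarrow>
            n2 * (n1 - t1) \<le> local_metric_dim (G \<boxtimes> H) \<and>
            local_metric_dim (G \<boxtimes> H) \<le> n2 * (n1 - t1) + t1)"
proof -
  interpret two_connected_pair_graphs G H
    by (intro two_connected_pair_graphs.intro connected_pair_graph.intro
        connected_pair_graph_axioms.intro) (fact assms)+
  \<comment> \<open>Hence \<open>n1 - (n1 - t1) = t1\<close> despite truncated subtraction, and
    likewise for \<open>H\<close>: these are the numbers of vertices omitted by minimum
    generators.\<close>
  have t: "t1 \<le> n1" "t2 \<le> n2"
    by (simp_all add: assms card_true_twin_classes_le)
  have lower: "n1 * n2 - t1 * t2 \<le> local_metric_dim (G \<boxtimes> H)"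
    using local_metric_dim_strong_product_ge assms by simp
  obtain S where S: "local_metric_generator G S" "card S = local_metric_dim G"
    by (rule G.local_metric_dim_attained)
  show ?thesis
  proof (intro conjI impI; elim conjE)
    assume dim: "local_metric_dim G = n1 - t1" "local_metric_dim H = n2 - t2"
    obtain T where T: "local_metric_generator H T" "card T = local_metric_dim H"
      by (rule H.local_metric_dim_attained)
    show "local_metric_dim (G \<boxtimes> H) = n1 * n2 - t1 * t2"
      using local_metric_dim_strong_product_le[OF S(1) T(1)] lower S(2) T(2) dim t assms by simp
  next
    \<comment> \<open>Replacing \<open>t2\<close> by \<open>n2\<close> weakens the general lower
      bound to the claimed one.\<close>
    have "n2 * (n1 - t1) = n1 * n2 - t1 * n2" by (simp add: algebra_simps)
    also have "\<dots> \<le> n1 * n2 - t1 * t2" using t by (intro diff_le_mono2) simp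
    also note lower
    finally show "n2 * (n1 - t1) \<le> local_metric_dim (G \<boxtimes> H)" .
  next
    assume dim: "local_metric_dim G = n1 - t1" and "bipartite H"
    have "pverts H \<noteq> {}" using assms by auto
    then obtain r where "r \<in> pverts H" by blast
    with \<open>bipartite H\<close> have "local_metric_generator H {r}"
      by (rule H.bipartite_singleton_generator)
    from local_metric_dim_strong_product_le[OF S(1) this]
    \<comment> \<open>The singleton \<open>{r}\<close> omits \<open>n2 - 1\<close> vertices of
      \<open>H\<close>, and \<open>S\<close> omits \<open>t1\<close> vertices of
      \<open>G\<close>.\<close>
    have "local_metric_dim (G \<boxtimes> H) \<le> n1 * n2 - t1 * (n2 - 1)"
      using S(2) dim t assms by simp
    also have "\<dots> \<le> n2 * (n1 - t1) + t1" by (simp add: algebra_simps)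
    finally show "local_metric_dim (G \<boxtimes> H) \<le> n2 * (n1 - t1) + t1" .
  qed
qed

end
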